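(* Let $n\ge 1$ and consider the integer lattice graph $\mathbb{Z}^n$. Suppose that $V:\mathbb{Z}^n\to\mathbb{R}$ satisfies, for some $\alpha\in[0,2]$ and $c_0>0$, $$V(x)\ge c_0\,(1+|x|)^{-\alpha}\quad\text{for all }x\in\mathbb{Z}^n .$$ Let $u:\mathbb{Z}^n\to\mathbb{R}$ be a subsolution of $\Delta u-Vu=0$ in $\mathbb{Z}^n$ such that $$\limsup_{|x|\to+\infty}\frac{u(x)}{|Z(x)|}\le 0,$$ where, whenever $|x|>2$, $Z(x):=-|x|^{2-\alpha}$ if $\alpha\in[0,2)$ and $Z(x):=-\log|x|$ if $\alpha=2$. Then $u(x)\le 0$ for all $x\in\mathbb{Z}^n$.
   Context: Integer lattice graph: the vertex set is $\mathbb{Z}^n$; $x\sim y$ if and only if there is $k\in\{1,\dots,n\}$ with $x_k=y_k\pm1$ and $x_i=y_i$ for $i\ne k$; the edge weight is $\omega(x,y)=1$ if $x\sim y$ and $0$ otherwise; the node measure is $\mu(x)=2n$. Here $|x|=\big(\sum_{k=1}^n|x_k|^2\big)^{1/2}$ is the Euclidean norm. The Laplace operator is $\Delta f(x)=\frac1{2n}\sum_{y\sim x}[f(y)-f(x)]$ for $f:\mathbb{Z}^n\to\mathbb{R}$. A function $u:\mathbb{Z}^n\to\mathbb{R}$ is a subsolution of $\Delta u-Vu=0$ in $\mathbb{Z}^n$ if $\Delta u(x)-V(x)u(x)\ge0$ for every $x\in\mathbb{Z}^n$. *)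

theory Defs
  imports "HOL-Analysis.Analysis"
begin

text \<open>
  The integer lattice \<open>\<int>\<^sup>n\<close> is the type \<open>int ^ 'n\<close> with \<open>n = CARD('n)\<close>.  The library norm on
  \<open>_ ^ 'n\<close> needs normed components, which \<open>int\<close> does not provide, hence a separate
  Euclidean norm.
\<close>

definition lattice_norm :: "int ^ 'n::finite \<Rightarrow> real" where
  "lattice_norm x = sqrt (\<Sum>k\<in>UNIV. \<bar>real_of_int (x $ k)\<bar>\<^sup>2)"

definition lattice_adj :: "int ^ 'n::finite \<Rightarrow> int ^ 'n \<Rightarrow> bool" where
  "lattice_adj x y \<longleftrightarrow>
     (\<exists>k. (x $ k = y $ k + 1 \<or> x $ k = y $ k - 1) \<and> (\<forall>i. i \<noteq> k \<longrightarrow> x $ i = y $ i))"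

text \<open>
  Sums over infinite sets are \<open>0\<close> by convention; this lemma shows that the sum in the
  definition of the Laplacian below is a genuine finite sum.
\<close>

lemma finite_lattice_adj: "finite {y. lattice_adj x (y :: int ^ 'n::finite)}"
proof -
  let ?g = "\<lambda>(k, d). \<chi> i. if i = k then x $ i + d else x $ i"
  have "{y. lattice_adj x y} \<subseteq> ?g ` (UNIV \<times> {1, -1})"
  proof
    fix y assume "y \<in> {y. lattice_adj x y}"
    then obtain k where k: "x $ k = y $ k + 1 \<or> x $ k = y $ k - 1"
      and i: "\<And>i. i \<noteq> k \<Longrightarrow> x $ i = y $ i"
      by (auto simp: lattice_adj_def)
    have "y = ?g (k, y $ k - x $ k)"
      using i by (auto simp: vec_eq_iff)
    moreover have "y $ k - x $ k \<in> {1, -1}" using k by auto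
    ultimately show "y \<in> ?g ` (UNIV \<times> {1, -1})" by blast
  qed
  then show ?thesis by (rule finite_subset) simp
qed

definition lattice_laplacian :: "(int ^ 'n::finite \<Rightarrow> real) \<Rightarrow> int ^ 'n \<Rightarrow> real" where
  "lattice_laplacian f x =
     1 / (2 * real CARD('n)) * (\<Sum>y | lattice_adj x y. f y - f x)"

definition lattice_subsolution ::
    "(int ^ 'n::finite \<Rightarrow> real) \<Rightarrow> (int ^ 'n \<Rightarrow> real) \<Rightarrow> bool" where
  "lattice_subsolution V u \<longleftrightarrow> (\<forall>x. lattice_laplacian u x - V x * u x \<ge> 0)"

text \<open>
  Only meaningful for \<open>lattice_norm x > 2\<close> and \<open>\<alpha> \<le> 2\<close>.  The values at the remaining
  (finitely many) lattice points do not affect limits at infinity.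
\<close>

definition lattice_Z :: "real \<Rightarrow> int ^ 'n::finite \<Rightarrow> real" where
  "lattice_Z \<alpha> x =
     (if \<alpha> < 2 then - (lattice_norm x powr (2 - \<alpha>)) else - ln (lattice_norm x))"

text \<open>The filter expressing \<open>|x| \<rightarrow> +\<infinity>\<close> on the lattice.\<close>

definition lattice_at_infinity :: "(int ^ 'n::finite) filter" where
  "lattice_at_infinity = filtercomap lattice_norm at_top"

end

theory Submission
  imports Defs
begin

text \<open>
  The proof compares \<open>u\<close> with small multiples of a positive supersolution \<open>W\<close> that grows at
  least as fast as \<open>\<bar>Z\<bar>\<close>.  Take \<open>W x = \<phi> (K + \<bar>x\<bar>\<^sup>2)\<close> with \<open>\<phi> s = s powr (1 - \<alpha> / 2)\<close>, or
  \<open>\<phi> = ln\<close> in the borderline case \<open>\<alpha> = 2\<close>.  Both functions are concave, and the squared norm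
  has Laplacian exactly \<open>1\<close>, because the linear terms of two opposite neighbours cancel.
  Replacing \<open>\<phi>\<close> by its tangent at \<open>s = K + \<bar>x\<bar>\<^sup>2\<close> therefore gives
  \<open>\<Delta>W x \<le> \<phi>' s \<le> s powr (- \<alpha> / 2)\<close>, without any Taylor expansion
  (\<open>lattice_laplacian_radial_le\<close>).  On the other hand \<open>V x \<ge> c\<^sub>0 / 2 * s powr (- \<alpha> / 2)\<close> as
  soon as \<open>K \<ge> 1\<close>, so \<open>\<Delta>W \<le> V W\<close> once \<open>K\<close> is so large that \<open>\<phi> K \<ge> 2 / c\<^sub>0\<close>; this is possible
  because \<open>\<phi>\<close> is unbounded (\<open>exists_growing_supersolution\<close>).

  For every \<open>\<epsilon> > 0\<close> the limsup condition makes \<open>u - \<epsilon> W\<close> a subsolution that is nonpositive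
  outside a finite set.  A positive value would force a positive maximum, where the
  Laplacian is at most \<open>0\<close> but has to be at least \<open>V\<close> times that maximum.  Hence
  \<open>u \<le> \<epsilon> W\<close> everywhere, and \<open>\<epsilon> \<rightarrow> 0\<close> gives the result (\<open>subsolution_nonpos_of_dominated\<close>).
\<close>

section \<open>The Euclidean norm on the lattice\<close>

lemma lattice_norm_nonneg: "0 \<le> lattice_norm x"
  by (simp add: lattice_norm_def sum_nonneg)

lemma lattice_norm_squared: "(lattice_norm x)\<^sup>2 = (\<Sum>k\<in>UNIV. (real_of_int (x $ k))\<^sup>2)"
  by (simp add: lattice_norm_def sum_nonneg)

lemma abs_component_le_lattice_norm: "\<bar>real_of_int (x $ k)\<bar> \<le> lattice_norm x"
proof -
  have "(real_of_int (x $ k))\<^sup>2 \<le> (lattice_norm x)\<^sup>2"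
    unfolding lattice_norm_squared by (rule member_le_sum) auto
  then show ?thesis
    by (simp add: abs_le_square_iff[symmetric] lattice_norm_nonneg)
qed

lemma finite_lattice_ball: "finite {x :: int ^ 'n::finite. lattice_norm x \<le> R}"
proof (rule finite_subset)
  show "finite (vec_lambda ` PiE (UNIV :: 'n set) (\<lambda>_. {- \<lceil>R\<rceil>..\<lceil>R\<rceil>}))"
    by (intro finite_imageI finite_PiE) auto
  show "{x :: int ^ 'n. lattice_norm x \<le> R} \<subseteq> vec_lambda ` PiE UNIV (\<lambda>_. {- \<lceil>R\<rceil>..\<lceil>R\<rceil>})"
  proof
    fix x :: "int ^ 'n" assume "x \<in> {x. lattice_norm x \<le> R}"
    then have "\<bar>real_of_int (x $ k)\<bar> \<le> R" for k
      using abs_component_le_lattice_norm[of x k] by simp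
    then have "\<bar>x $ k\<bar> \<le> \<lceil>R\<rceil>" for k
      by (metis ceiling_mono ceiling_of_int of_int_abs)
    then have "vec_nth x \<in> PiE UNIV (\<lambda>_. {- \<lceil>R\<rceil>..\<lceil>R\<rceil>})"
      by (auto simp: abs_le_iff minus_le_iff)
    then show "x \<in> vec_lambda ` PiE UNIV (\<lambda>_. {- \<lceil>R\<rceil>..\<lceil>R\<rceil>})"
      by (metis image_eqI vec_nth_inverse)
  qed
qed

lemma sum_lattice_adj:
  fixes x :: "int ^ 'n::finite"
  shows "(\<Sum>y | lattice_adj x y. f y) = (\<Sum>k\<in>UNIV. f (x + axis k 1) + f (x + axis k (- 1)))"
proof -
  let ?g = "\<lambda>(k, d). x + axis k d"
  have inj: "inj_on ?g (UNIV \<times> {1, - 1})"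
    by (auto simp: inj_on_def axis_eq_axis)
  have "{y. lattice_adj x y} = ?g ` (UNIV \<times> {1, - 1})"
  proof (intro equalityI subsetI)
    fix y assume "y \<in> {y. lattice_adj x y}"
    then obtain k where k: "x $ k = y $ k + 1 \<or> x $ k = y $ k - 1"
      and i: "\<And>i. i \<noteq> k \<Longrightarrow> x $ i = y $ i"
      by (auto simp: lattice_adj_def)
    have "y = ?g (k, y $ k - x $ k)"
      using i by (auto simp: vec_eq_iff axis_def)
    moreover have "y $ k - x $ k \<in> {1, - 1}" using k by auto
    ultimately show "y \<in> ?g ` (UNIV \<times> {1, - 1})" by blast
  next
    fix y assume "y \<in> ?g ` (UNIV \<times> {1, - 1})"
    then show "y \<in> {y. lattice_adj x y}"
      by (auto simp: lattice_adj_def axis_def)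
  qed
  then have "(\<Sum>y | lattice_adj x y. f y) = (\<Sum>p\<in>UNIV \<times> {1, - 1}. f (?g p))"
    using inj by (simp add: sum.reindex)
  also have "\<dots> = (\<Sum>k\<in>UNIV. \<Sum>d\<in>{1, - 1}. f (x + axis k d))"
    by (simp only: sum.cartesian_product case_prod_unfold)
  finally show ?thesis by simp
qed

lemma lattice_norm_squared_add_axis:
  "(lattice_norm (x + axis k d))\<^sup>2 = (lattice_norm x)\<^sup>2 + 2 * of_int d * of_int (x $ k) + (of_int d)\<^sup>2"
proof -
  have "(real_of_int ((x + axis k d) $ i))\<^sup>2 = (real_of_int (x $ i))\<^sup>2
      + (if i = k then 2 * of_int d * of_int (x $ k) + (of_int d)\<^sup>2 else 0)" for i
    by (auto simp: axis_def power2_eq_square algebra_simps)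
  then show ?thesis
    by (simp add: lattice_norm_squared sum.distrib)
qed

section \<open>The lattice Laplacian\<close>

lemma lattice_laplacian_mono_at:
  assumes "\<And>y. lattice_adj x y \<Longrightarrow> f y - f x \<le> g y - g x"
  shows "lattice_laplacian f x \<le> lattice_laplacian g x"
  unfolding lattice_laplacian_def using assms
  by (intro mult_left_mono sum_mono) auto

lemma lattice_laplacian_diff_scale:
  "lattice_laplacian (\<lambda>y. f y - c * g y) x = lattice_laplacian f x - c * lattice_laplacian g x"
proof -
  have "(\<Sum>y | lattice_adj x y. f y - c * g y - (f x - c * g x))
      = (\<Sum>y | lattice_adj x y. f y - f x) - c * (\<Sum>y | lattice_adj x y. g y - g x)"
    by (simp add: sum_distrib_left algebra_simps flip: sum_subtractf)
  then show ?thesis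
    by (simp only: lattice_laplacian_def right_diff_distrib) (simp add: mult.left_commute)
qed

lemma lattice_laplacian_norm_squared:
  "lattice_laplacian (\<lambda>y. (lattice_norm y)\<^sup>2) x = 1"
  by (simp add: lattice_laplacian_def sum_lattice_adj lattice_norm_squared_add_axis)

text \<open>
  A concave radial function lies below its tangent, which is affine in the squared norm;
  so its Laplacian is at most the slope of that tangent.
\<close>

lemma lattice_laplacian_radial_le:
  assumes tangent: "\<And>t. 0 \<le> t \<Longrightarrow> \<phi> t \<le> \<phi> ((lattice_norm x)\<^sup>2) + m * (t - (lattice_norm x)\<^sup>2)"
  shows "lattice_laplacian (\<lambda>y. \<phi> ((lattice_norm y)\<^sup>2)) x \<le> m"
proof -
  \<comment> \<open>the tangent without its constant term, in the form \<open>f - c * g\<close> with \<open>f = 0\<close>\<close>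
  have "lattice_laplacian (\<lambda>y. \<phi> ((lattice_norm y)\<^sup>2)) x
      \<le> lattice_laplacian (\<lambda>y. 0 - (- m) * (lattice_norm y)\<^sup>2) x"
  proof (rule lattice_laplacian_mono_at)
    fix y
    show "\<phi> ((lattice_norm y)\<^sup>2) - \<phi> ((lattice_norm x)\<^sup>2)
        \<le> (0 - (- m) * (lattice_norm y)\<^sup>2) - (0 - (- m) * (lattice_norm x)\<^sup>2)"
      using tangent[of "(lattice_norm y)\<^sup>2"] by (simp add: algebra_simps)
  qed
  also have "\<dots> = m"
    by (subst lattice_laplacian_diff_scale)
       (simp add: lattice_laplacian_norm_squared lattice_laplacian_def)
  finally show ?thesis .
qed

section \<open>Comparison principles\<close>

text \<open>
  This is the maximum principle.  Nonpositivity at infinity confines positive values to a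
  finite set, so a positive value would yield a positive global maximum, where the Laplacian
  cannot be positive.
\<close>

lemma subsolution_nonpos_of_eventually_nonpos:
  fixes v :: "int ^ 'n::finite \<Rightarrow> real"
  assumes V: "\<And>x. 0 < V x" and sub: "lattice_subsolution V v"
    and ev: "eventually (\<lambda>x. v x \<le> 0) lattice_at_infinity"
  shows "v x \<le> 0"
proof (rule ccontr)
  assume pos: "\<not> v x \<le> 0"
  obtain R where R: "\<And>y. R \<le> lattice_norm y \<Longrightarrow> v y \<le> 0"
    using ev by (auto simp: lattice_at_infinity_def eventually_filtercomap eventually_at_top_linorder)
  have "{y. 0 < v y} \<subseteq> {y. lattice_norm y \<le> R}"
    using R by (metis (mono_tags, lifting) Collect_mono less_le_not_le linear)
  then have "finite {y. 0 < v y}"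
    by (rule finite_subset) (rule finite_lattice_ball)
  moreover have "{y. 0 < v y} \<noteq> {}" using pos not_le by blast
  ultimately obtain m where "0 < v m" and "\<And>y. 0 < v y \<Longrightarrow> v y \<le> v m"
    using Max_in[of "v ` {y. 0 < v y}"] Max_ge[of "v ` {y. 0 < v y}"] by fastforce
  then have max: "v y \<le> v m" for y
    by (cases "0 < v y") auto
  have "lattice_laplacian v m \<le> lattice_laplacian (\<lambda>_. 0) m"
    using max by (intro lattice_laplacian_mono_at) simp
  then have "lattice_laplacian v m \<le> 0"
    by (simp add: lattice_laplacian_def)
  moreover have "V m * v m \<le> lattice_laplacian v m"
    using sub by (simp add: lattice_subsolution_def)
  moreover have "0 < V m * v m"
    using V \<open>0 < v m\<close> by simp
  ultimately show False by linarith
qed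

text \<open>
  A Phragmen--Lindelof principle: a subsolution that grows more slowly than a supersolution
  is nonpositive, by applying the maximum principle to \<open>u - \<epsilon> W\<close> and letting \<open>\<epsilon> \<rightarrow> 0\<close>.
\<close>

lemma subsolution_nonpos_of_dominated:
  fixes u W :: "int ^ 'n::finite \<Rightarrow> real"
  assumes V: "\<And>x. 0 < V x" and sub: "lattice_subsolution V u"
    and super: "\<And>x. lattice_laplacian W x \<le> V x * W x"
    and dom: "\<And>\<epsilon>. 0 < \<epsilon> \<Longrightarrow> eventually (\<lambda>x. u x \<le> \<epsilon> * W x) lattice_at_infinity"
  shows "u x \<le> 0"
proof (rule field_le_epsilon)
  have bound: "u x \<le> \<epsilon> * W x" if "0 < \<epsilon>" for \<epsilon>
  proof -
    have "lattice_subsolution V (\<lambda>x. u x - \<epsilon> * W x)"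
      unfolding lattice_subsolution_def
    proof
      fix y
      have "\<epsilon> * lattice_laplacian W y \<le> \<epsilon> * (V y * W y)"
        using super that by (intro mult_left_mono) auto
      moreover have "V y * u y \<le> lattice_laplacian u y"
        using sub by (simp add: lattice_subsolution_def)
      ultimately show "0 \<le> lattice_laplacian (\<lambda>x. u x - \<epsilon> * W x) y - V y * (u y - \<epsilon> * W y)"
        by (simp add: lattice_laplacian_diff_scale algebra_simps)
    qed
    moreover have "eventually (\<lambda>x. u x - \<epsilon> * W x \<le> 0) lattice_at_infinity"
      using dom[OF that] by simp
    ultimately show ?thesis
      using subsolution_nonpos_of_eventually_nonpos[where V = V and x = x
          and v = "\<lambda>x. u x - \<epsilon> * W x"] V by simp
  qed
  fix \<delta> :: real assume "0 < \<delta>"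
  \<comment> \<open>the summand \<open>1\<close> keeps the denominator positive when \<open>W x = 0\<close>\<close>
  have "u x \<le> \<delta> / (1 + \<bar>W x\<bar>) * W x"
    using \<open>0 < \<delta>\<close> by (intro bound) auto
  also have "\<dots> \<le> \<delta>"
    using \<open>0 < \<delta>\<close> mult_left_mono[of "W x" "1 + \<bar>W x\<bar>" \<delta>] by (simp add: pos_divide_le_eq)
  finally show "u x \<le> 0 + \<delta>" by simp
qed

section \<open>Supersolutions of prescribed growth\<close>

lemma power2_powr_half:
  fixes a b :: real
  assumes "0 \<le> a"
  shows "(a\<^sup>2) powr (b / 2) = a powr b"
  using assms by (simp add: power2_eq_square powr_mult flip: powr_add)

lemma powr_le_tangent:
  fixes s t \<beta> :: real
  assumes "0 < s" "0 < t" "0 \<le> \<beta>" "\<beta> \<le> 1"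
  shows "t powr \<beta> \<le> s powr \<beta> + \<beta> * s powr (\<beta> - 1) * (t - s)"
proof -
  have "t powr \<beta> = (t powr \<beta> * s powr (1 - \<beta>)) * s powr (\<beta> - 1)"
    using assms by (simp add: mult.assoc flip: powr_add)
  also have "\<dots> \<le> (\<beta> * t + (1 - \<beta>) * s) * s powr (\<beta> - 1)"
    using assms by (intro mult_right_mono Youngs_inequality_0) auto
  also have "\<dots> = \<beta> * s powr (\<beta> - 1) * (t - s) + s * s powr (\<beta> - 1)"
    by (simp add: algebra_simps)
  also have "s * s powr (\<beta> - 1) = s powr \<beta>"
    using assms by (simp add: powr_mult_base)
  finally show ?thesis by simp
qed

lemma ln_le_tangent:
  fixes s t :: real
  assumes "0 < s" "0 < t"
  shows "ln t \<le> ln s + 1 / s * (t - s)"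
  using ln_le_minus_one[of "t / s"] assms by (simp add: ln_div field_simps)

text \<open>
  For \<open>s = K + \<bar>x\<bar>\<^sup>2\<close>, both the slope bound on \<open>\<phi>\<close> and the lower bound on \<open>V\<close> are multiples of
  \<open>s powr (- \<alpha> / 2)\<close>; since \<open>\<phi> s\<close> is bounded below by a large constant, it absorbs the
  possibly small factor \<open>c\<close>.  The powers and the logarithm are instances.
\<close>

lemma radial_supersolution:
  fixes V :: "int ^ 'n::finite \<Rightarrow> real"
  assumes \<alpha>: "0 \<le> \<alpha>" "\<alpha> \<le> 2" and "0 < c" and "1 \<le> K"
    and V: "\<And>x. c * (1 + lattice_norm x) powr (- \<alpha>) \<le> V x"
    and tangent: "\<And>s t. 0 < s \<Longrightarrow> 0 < t \<Longrightarrow> \<phi> t \<le> \<phi> s + \<phi>' s * (t - s)"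
    and slope: "\<And>s. 0 < s \<Longrightarrow> \<phi>' s \<le> s powr (- \<alpha> / 2)"
    and K: "\<And>s. K \<le> s \<Longrightarrow> 2 / c \<le> \<phi> s"
  shows "lattice_laplacian (\<lambda>x. \<phi> (K + (lattice_norm x)\<^sup>2)) x \<le> V x * \<phi> (K + (lattice_norm x)\<^sup>2)"
proof -
  define r where "r = lattice_norm x"
  define s where "s = K + r\<^sup>2"
  have r: "0 \<le> r" by (simp add: r_def lattice_norm_nonneg)
  have s: "K \<le> s" "0 < s" using \<open>1 \<le> K\<close> by (auto simp: s_def add_pos_nonneg)
  have "lattice_laplacian (\<lambda>x. \<phi> (K + (lattice_norm x)\<^sup>2)) x \<le> \<phi>' s"
  proof (rule lattice_laplacian_radial_le)
    fix t :: real assume "0 \<le> t"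
    then show "\<phi> (K + t) \<le> \<phi> (K + (lattice_norm x)\<^sup>2) + \<phi>' s * (t - (lattice_norm x)\<^sup>2)"
      using tangent[of s "K + t"] s \<open>1 \<le> K\<close> by (simp add: s_def r_def)
  qed
  also have "\<dots> \<le> s powr (- \<alpha> / 2)" using slope s by blast
  also have "\<dots> \<le> (c / 2 * s powr (- \<alpha> / 2)) * \<phi> s"
  proof -
    have "1 \<le> c / 2 * \<phi> s" using K[OF s(1)] \<open>0 < c\<close> by (simp add: field_simps)
    then show ?thesis using mult_left_mono[of 1 "c / 2 * \<phi> s" "s powr (- \<alpha> / 2)"]
      by (simp add: ac_simps)
  qed
  also have "\<dots> \<le> V x * \<phi> s"
  proof (rule mult_right_mono)
    have "1 / 2 = 2 powr (- 1 :: real)" by (simp add: powr_minus)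
    also have "\<dots> \<le> 2 powr (- \<alpha> / 2)" using \<alpha> by (intro powr_mono) auto
    finally have "1 / 2 * s powr (- \<alpha> / 2) \<le> 2 powr (- \<alpha> / 2) * s powr (- \<alpha> / 2)"
      by (intro mult_right_mono) auto
    also have "\<dots> = (2 * s) powr (- \<alpha> / 2)"
      using s by (simp add: powr_mult)
    also have "\<dots> \<le> ((1 + r)\<^sup>2) powr (- \<alpha> / 2)"
    proof (rule powr_mono2')
      \<comment> \<open>\<open>(1 + r)\<^sup>2 \<le> 2 * (1 + r\<^sup>2)\<close>, because the difference is \<open>(1 - r)\<^sup>2\<close>\<close>
      show "(1 + r)\<^sup>2 \<le> 2 * s"
        using \<open>1 \<le> K\<close> zero_le_power2[of "1 - r"]
        by (simp add: s_def power2_eq_square algebra_simps)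
    qed (use \<alpha> r in auto)
    also have "\<dots> = (1 + r) powr (- \<alpha>)"
      using r power2_powr_half[of "1 + r" "- \<alpha>"] by simp
    finally have "c * (1 / 2 * s powr (- \<alpha> / 2)) \<le> c * (1 + r) powr (- \<alpha>)"
      using \<open>0 < c\<close> by (intro mult_left_mono) auto
    then show "c / 2 * s powr (- \<alpha> / 2) \<le> V x"
      using V[of x] by (simp add: r_def)
    show "0 \<le> \<phi> s" using K[OF s(1)] \<open>0 < c\<close> by (smt (verit) divide_pos_pos)
  qed
  finally show ?thesis by (simp add: s_def r_def)
qed

lemma exists_growing_supersolution:
  fixes V :: "int ^ 'n::finite \<Rightarrow> real"
  assumes \<alpha>: "0 \<le> \<alpha>" "\<alpha> \<le> 2" and "0 < c"
    and V: "\<And>x. c * (1 + lattice_norm x) powr (- \<alpha>) \<le> V x"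
  obtains W where "\<And>x. lattice_laplacian W x \<le> V x * W x"
    and "\<And>x. 1 < lattice_norm x \<Longrightarrow> \<bar>lattice_Z \<alpha> x\<bar> \<le> W x"
proof (cases "\<alpha> < 2")
  case True
  define \<beta> where "\<beta> = 1 - \<alpha> / 2"
  have \<beta>: "0 < \<beta>" "\<beta> \<le> 1" using \<alpha> True by (auto simp: \<beta>_def)
  \<comment> \<open>the second entry is the \<open>k\<close> with \<open>k powr \<beta> = 2 / c\<close>\<close>
  define K where "K = max 1 ((2 / c) powr (1 / \<beta>))"
  have "lattice_laplacian (\<lambda>x. (K + (lattice_norm x)\<^sup>2) powr \<beta>) x
      \<le> V x * (K + (lattice_norm x)\<^sup>2) powr \<beta>" for x
  proof (rule radial_supersolution[where \<phi> = "\<lambda>s. s powr \<beta>"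
        and \<phi>' = "\<lambda>s. \<beta> * s powr (\<beta> - 1)", OF \<alpha> \<open>0 < c\<close> _ V])
    fix s t :: real
    show "t powr \<beta> \<le> s powr \<beta> + \<beta> * s powr (\<beta> - 1) * (t - s)" if "0 < s" "0 < t"
      using that \<beta> by (intro powr_le_tangent) auto
    show "\<beta> * s powr (\<beta> - 1) \<le> s powr (- \<alpha> / 2)"
      using mult_right_mono[OF \<beta>(2), of "s powr (\<beta> - 1)"] by (simp add: \<beta>_def)
    assume "K \<le> s"
    then have "((2 / c) powr (1 / \<beta>)) powr \<beta> \<le> s powr \<beta>"
      using \<beta> by (intro powr_mono2) (auto simp: K_def)
    then show "2 / c \<le> s powr \<beta>"
      using \<beta> \<open>0 < c\<close> by (simp add: powr_powr)
  qed (simp add: K_def)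
  moreover have "\<bar>lattice_Z \<alpha> x\<bar> \<le> (K + (lattice_norm x)\<^sup>2) powr \<beta>" if "1 < lattice_norm x" for x :: "int ^ 'n"
  proof -
    have "\<bar>lattice_Z \<alpha> x\<bar> = ((lattice_norm x)\<^sup>2) powr \<beta>"
      using True that power2_powr_half[of "lattice_norm x" "2 - \<alpha>"]
      by (simp add: lattice_Z_def \<beta>_def diff_divide_distrib)
    also have "\<dots> \<le> (K + (lattice_norm x)\<^sup>2) powr \<beta>"
      using \<beta> by (intro powr_mono2) (auto simp: K_def)
    finally show ?thesis .
  qed
  ultimately show ?thesis by (rule that)
next
  case False
  then have "\<alpha> = 2" using \<alpha> by simp
  define K where "K = exp (2 / c)"
  have "1 \<le> K" using \<open>0 < c\<close> by (simp add: K_def)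
  have "lattice_laplacian (\<lambda>x. ln (K + (lattice_norm x)\<^sup>2)) x
      \<le> V x * ln (K + (lattice_norm x)\<^sup>2)" for x
  proof (rule radial_supersolution[where \<phi> = ln and \<phi>' = "\<lambda>s. 1 / s",
        OF \<alpha> \<open>0 < c\<close> \<open>1 \<le> K\<close> V])
    fix s t :: real
    show "ln t \<le> ln s + 1 / s * (t - s)" if "0 < s" "0 < t"
      using that by (rule ln_le_tangent)
    show "1 / s \<le> s powr (- \<alpha> / 2)" if "0 < s"
      using that \<open>\<alpha> = 2\<close> by (simp add: powr_minus_divide)
    assume "K \<le> s"
    then have "ln K \<le> ln s"
      using \<open>1 \<le> K\<close> by (intro ln_mono) auto
    then show "2 / c \<le> ln s"
      by (simp add: K_def)
  qed
  moreover have "\<bar>lattice_Z \<alpha> x\<bar> \<le> ln (K + (lattice_norm x)\<^sup>2)" if "1 < lattice_norm x" for x :: "int ^ 'n"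
  proof -
    have "lattice_norm x \<le> (lattice_norm x)\<^sup>2"
      using that by (simp add: power2_eq_square)
    then have "ln (lattice_norm x) \<le> ln (K + (lattice_norm x)\<^sup>2)"
      using that \<open>1 \<le> K\<close> by (intro ln_mono) auto
    then show ?thesis using \<open>\<alpha> = 2\<close> that by (simp add: lattice_Z_def)
  qed
  ultimately show ?thesis by (rule that)
qed

section \<open>The Liouville property\<close>

theorem theorem3p10:
  fixes V u :: "int ^ 'n::finite \<Rightarrow> real" and \<alpha> c\<^sub>0 :: real
  assumes "0 \<le> \<alpha>" and "\<alpha> \<le> 2" and "c\<^sub>0 > 0"
    and "\<forall>x. V x \<ge> c\<^sub>0 * (1 + lattice_norm x) powr (- \<alpha>)"
    and "lattice_subsolution V u"
    and "Limsup lattice_at_infinity (\<lambda>x. ereal (u x / \<bar>lattice_Z \<alpha> x\<bar>)) \<le> 0"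
  shows "\<forall>x. u x \<le> 0"
proof
  fix x
  have V: "c\<^sub>0 * (1 + lattice_norm x) powr (- \<alpha>) \<le> V x" for x
    using assms(4) by blast
  have V_pos: "0 < V x" for x
    by (rule less_le_trans[OF _ V]) (use \<open>c\<^sub>0 > 0\<close> lattice_norm_nonneg[of x] in auto)
  obtain W where super: "\<And>x. lattice_laplacian W x \<le> V x * W x"
    and growth: "\<And>x. 1 < lattice_norm x \<Longrightarrow> \<bar>lattice_Z \<alpha> x\<bar> \<le> W x"
    using exists_growing_supersolution[OF assms(1-3) V] by blast
  show "u x \<le> 0"
  proof (rule subsolution_nonpos_of_dominated[where V = V and W = W, OF V_pos assms(5) super])
    fix \<epsilon> :: real assume "0 < \<epsilon>"
    then have "Limsup lattice_at_infinity (\<lambda>x. ereal (u x / \<bar>lattice_Z \<alpha> x\<bar>)) < ereal \<epsilon>"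
      using assms(6) by (simp add: order_le_less_trans)
    then have "eventually (\<lambda>x. ereal (u x / \<bar>lattice_Z \<alpha> x\<bar>) < ereal \<epsilon>) lattice_at_infinity"
      by (rule Limsup_lessD)
    moreover have "eventually (\<lambda>x::int ^ 'n. 1 < lattice_norm x) lattice_at_infinity"
      unfolding lattice_at_infinity_def
      by (rule eventually_filtercomapI) (rule eventually_gt_at_top)
    ultimately show "eventually (\<lambda>x. u x \<le> \<epsilon> * W x) lattice_at_infinity"
    proof eventually_elim
      case (elim x)
      have "lattice_Z \<alpha> x \<noteq> 0"
        using elim by (auto simp: lattice_Z_def)
      then have "u x \<le> \<epsilon> * \<bar>lattice_Z \<alpha> x\<bar>"
        using elim by (simp add: pos_divide_less_eq)
      also have "\<dots> \<le> \<epsilon> * W x"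
        using \<open>0 < \<epsilon>\<close> growth elim by (intro mult_left_mono) auto
      finally show ?case .
    qed
  qed
qed

end
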